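(* Let $K$ be $\mathbb{R}$ or $\mathbb{C}$, let $V$ be an $m$-dimensional vector space over $K$ equipped with a non-degenerate symmetric bilinear form $\langle\cdot,\cdot\rangle$, and let $V^n$ be equipped with a norm $\|\cdot\|$. Let $r=\min(n-1,m)$. Suppose that an $n$-point configuration $P_1,\ldots,P_n\in V$ with distances $d_{\{i,j\}}=\langle P_i-P_j,P_i-P_j\rangle$ is such that the matrix $$\left(d_{\{i,j\}}-d_{\{i,n\}}-d_{\{j,n\}}\right)_{i,j=1,\ldots,n-1}$$ (where $d_{\{i,i\}}:=0$) has rank $r$. Then there exists an $\epsilon>0$ such that if $Q_1,\ldots,Q_n\in V$ is an $n$-point configuration with the same distribution of distances as that of $P_1,\ldots,P_n$ and with $\|(Q_1,\ldots,Q_n)-(P_1,\ldots,P_n)\|<\epsilon$, then $(Q_1,\ldots,Q_n)$ and $(P_1,\ldots,P_n)$ are in the same orbit relative to $\mathrm{AO}(V)$.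
   Context: $\mathrm{O}(V)$ is the orthogonal group of the form $\langle\cdot,\cdot\rangle$, and $\mathrm{AO}(V)$ is the group of maps $V\to V$ generated by $\mathrm{O}(V)$ and all translations; it acts diagonally on $V^n$ by $g\cdot(Q_1,\ldots,Q_n)=(g(Q_1),\ldots,g(Q_n))$. Two configurations $(Q_1,\ldots,Q_n)$ and $(P_1,\ldots,P_n)$ have the same distribution of distances if the multisets $\{\langle Q_i-Q_j,Q_i-Q_j\rangle : 1\le i<j\le n\}$ and $\{\langle P_i-P_j,P_i-P_j\rangle : 1\le i<j\le n\}$ coincide. *)

theory Defs
  imports
    Complex_Main
    "HOL-Library.Multiset"
    "HOL-Algebra.Generated_Groups"
    "HOL-Algebra.Group_Action"
    "Jordan_Normal_Form.DL_Rank"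
begin

text \<open>The scalar field is the real or the complex numbers. The class says that every scalar is real,
  or that every scalar is \<open>a + b i\<close> with \<open>a\<close>, \<open>b\<close> real and \<open>i\<^sup>2 = -1\<close>; as the norm of
  \<^class>\<open>real_normed_field\<close> is multiplicative, the norm is then the usual absolute value.\<close>

class real_or_complex = real_normed_field +
  assumes real_or_complex:
    "(\<forall>z. \<exists>a. z = a *\<^sub>R 1) \<or>
     (\<exists>i. i * i = -1 \<and> (\<forall>z. \<exists>a b. z = a *\<^sub>R 1 + b *\<^sub>R i))"

instance real :: real_or_complex
  by standard simp

instance complex :: real_or_complex
proof
  have "z = Re z *\<^sub>R 1 + Im z *\<^sub>R \<i>" for z
    by (simp add: complex_eq_iff)
  then show "(\<forall>z::complex. \<exists>a. z = a *\<^sub>R 1) \<or>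
      (\<exists>i::complex. i * i = -1 \<and> (\<forall>z. \<exists>a b. z = a *\<^sub>R 1 + b *\<^sub>R i))"
    using i_squared by blast
qed

definition nondegenerate_symmetric_bilinear_form ::
  "('k::field \<Rightarrow> 'v::ab_group_add \<Rightarrow> 'v) \<Rightarrow> ('v \<Rightarrow> 'v \<Rightarrow> 'k) \<Rightarrow> bool" where
  "nondegenerate_symmetric_bilinear_form scale form \<longleftrightarrow>
     (\<forall>x. Vector_Spaces.linear scale (*) (\<lambda>y. form x y)) \<and>
     (\<forall>y. Vector_Spaces.linear scale (*) (\<lambda>x. form x y)) \<and>
     (\<forall>x y. form x y = form y x) \<and>
     (\<forall>x. (\<forall>y. form x y = 0) \<longrightarrow> x = 0)"

definition orthogonal_maps ::
  "('k::field \<Rightarrow> 'v::ab_group_add \<Rightarrow> 'v) \<Rightarrow> ('v \<Rightarrow> 'v \<Rightarrow> 'k) \<Rightarrow> ('v \<Rightarrow> 'v) set" where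
  "orthogonal_maps scale form =
     {g. Vector_Spaces.linear scale scale g \<and> bij g \<and> (\<forall>x y. form (g x) (g y) = form x y)}"

definition translation_maps :: "('v::ab_group_add \<Rightarrow> 'v) set" where
  "translation_maps = range (\<lambda>v x. x + v)"

text \<open>\<open>AO(V)\<close>, as a group under composition: the subgroup of the group of all bijections of \<open>V\<close>
  generated by \<open>O(V)\<close> and the translations.\<close>

definition AO ::
  "('k::field \<Rightarrow> 'v::ab_group_add \<Rightarrow> 'v) \<Rightarrow> ('v \<Rightarrow> 'v \<Rightarrow> 'k) \<Rightarrow> ('v \<Rightarrow> 'v) monoid" where
  "AO scale form =
     (BijGroup UNIV)\<lparr>carrier :=
        generate (BijGroup UNIV) (orthogonal_maps scale form \<union> translation_maps)\<rparr>"

text \<open>\<open>V\<^sup>n\<close> consists of the functions with values in \<open>V\<close> on the index set \<open>{1..n}\<close>, extended by \<open>0\<close>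
  to all natural numbers, so that the vector space operations of \<open>V\<^sup>n\<close> are the pointwise ones.\<close>

definition configurations :: "nat \<Rightarrow> (nat \<Rightarrow> 'v::zero) set" where
  "configurations n = {Q. \<forall>i. i \<notin> {1..n} \<longrightarrow> Q i = 0}"

definition diagonal_action :: "nat \<Rightarrow> ('v \<Rightarrow> 'v) \<Rightarrow> (nat \<Rightarrow> 'v) \<Rightarrow> nat \<Rightarrow> 'v::zero" where
  "diagonal_action n g Q = (\<lambda>i. if i \<in> {1..n} then g (Q i) else 0)"

text \<open>A norm on \<open>V\<^sup>n\<close>; its values outside \<^const>\<open>configurations\<close> are irrelevant.\<close>

definition norm_on_configurations ::
  "('k::real_normed_field \<Rightarrow> 'v::ab_group_add \<Rightarrow> 'v) \<Rightarrow> nat \<Rightarrow> ((nat \<Rightarrow> 'v) \<Rightarrow> real) \<Rightarrow> bool" where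
  "norm_on_configurations scale n N \<longleftrightarrow>
     (\<forall>Q \<in> configurations n. 0 \<le> N Q) \<and>
     (\<forall>Q \<in> configurations n. N Q = 0 \<longleftrightarrow> (\<forall>i. Q i = 0)) \<and>
     (\<forall>a. \<forall>Q \<in> configurations n. N (\<lambda>i. scale a (Q i)) = norm a * N Q) \<and>
     (\<forall>Q \<in> configurations n. \<forall>R \<in> configurations n. N (\<lambda>i. Q i + R i) \<le> N Q + N R)"

definition distance :: "('v::ab_group_add \<Rightarrow> 'v \<Rightarrow> 'k) \<Rightarrow> (nat \<Rightarrow> 'v) \<Rightarrow> nat \<Rightarrow> nat \<Rightarrow> 'k" where
  "distance form Q i j = form (Q i - Q j) (Q i - Q j)"

definition distance_distribution ::
  "('v::ab_group_add \<Rightarrow> 'v \<Rightarrow> 'k) \<Rightarrow> nat \<Rightarrow> (nat \<Rightarrow> 'v) \<Rightarrow> 'k multiset" where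
  "distance_distribution form n Q =
     image_mset (\<lambda>(i, j). distance form Q i j) (mset_set {(i, j). 1 \<le> i \<and> i < j \<and> j \<le> n})"

text \<open>Matrix indices start at \<open>0\<close>, so the entry at \<open>(i, j)\<close> belongs to the points with indices
  \<open>i + 1\<close> and \<open>j + 1\<close>. The convention \<open>d\<^sub>i\<^sub>i = 0\<close> holds because \<^term>\<open>distance form P i i = form 0 0\<close>
  and the form is bilinear.\<close>

definition distance_matrix ::
  "('v::ab_group_add \<Rightarrow> 'v \<Rightarrow> 'k::field) \<Rightarrow> nat \<Rightarrow> (nat \<Rightarrow> 'v) \<Rightarrow> 'k mat" where
  "distance_matrix form n P =
     mat (n - 1) (n - 1) (\<lambda>(i, j).
       distance form P (i + 1) (j + 1) - distance form P (i + 1) n - distance form P (j + 1) n)"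

end

theory Submission
  imports Defs
begin

text \<open>Two independent facts combine.

  Near \<open>P\<close> the distribution of distances determines the distances themselves. They depend continuously
  on the configuration, and those of a configuration with the same distribution come from the finite
  set of distances of \<open>P\<close>, so for a small perturbation each one stays what it was
  (\<open>same_distances_nearby\<close>). Continuity with respect to an arbitrary norm is the statement that a norm
  on \<open>K\<^sup>I\<close> bounds the coordinates (\<open>norm_bounds_coordinates\<close>), which rests on \<open>K\<close> being complete.

  Configurations with equal distances are congruent when the matrix has rank \<open>r\<close>. After moving the last
  point to the origin, the matrix is \<open>-2\<close> times the Gram matrix of the vectors \<open>P\<^sub>i - P\<^sub>n\<close>. Their span
  has dimension at most \<open>r = min (n - 1) m\<close>, and so does that of the vectors \<open>Q\<^sub>i - Q\<^sub>n\<close>; as the common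
  Gram matrix has rank \<open>r\<close>, the form restricted to either span has no radical (\<open>radical_trivial\<close>).
  Hence \<open>P\<^sub>i - P\<^sub>n \<mapsto> Q\<^sub>i - Q\<^sub>n\<close> is an isometry between nondegenerate subspaces. To extend it
  to \<open>V\<close> one needs the orthogonal complements to be isometric as well, which over the reals, where the
  form may be indefinite, is not a matter of dimension only; this is Witt's theorem, proved with reflections
  (\<open>nondegenerate_isometry_extends\<close>). Composing the extension with a translation gives the required element
  of \<open>AO(V)\<close>.\<close>

section \<open>Completeness of the scalar field\<close>

text \<open>If \<open>i\<^sup>2 = -1\<close> then \<open>(a + b i) (a - b i) = a\<^sup>2 + b\<^sup>2\<close>. Since the norm is multiplicative and
  \<open>a - b i\<close> has norm at most \<open>\<bar>a\<bar> + \<bar>b\<bar>\<close>, the factor \<open>a + b i\<close> cannot be small.\<close>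

lemma abs_add_abs_le_norm:
  fixes i :: "'k::real_normed_field"
  assumes i: "i * i = -1"
  shows "\<bar>a\<bar> + \<bar>b\<bar> \<le> 2 * norm (a *\<^sub>R 1 + b *\<^sub>R i)"
proof (cases "a = 0 \<and> b = 0")
  case False
  have "norm i * norm i = 1"
    using i by (metis norm_minus_cancel norm_mult norm_one)
  then have ni: "norm i = 1"
    by (metis norm_ge_zero power2_eq_square real_sqrt_abs real_sqrt_one abs_of_nonneg)
  have "(a *\<^sub>R 1 + b *\<^sub>R i) * (a *\<^sub>R 1 - b *\<^sub>R i) = (a * a) *\<^sub>R 1 - (b * b) *\<^sub>R (i * i)"
    by (simp add: algebra_simps)
  also have "\<dots> = of_real (a * a + b * b)"
    unfolding i by (simp add: of_real_def scaleR_add_left)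
  finally have "norm (a *\<^sub>R 1 + b *\<^sub>R i) * norm (a *\<^sub>R 1 - b *\<^sub>R i) = a * a + b * b"
    by (metis abs_of_nonneg add_nonneg_nonneg norm_mult norm_of_real zero_le_square)
  moreover have "norm (a *\<^sub>R 1 - b *\<^sub>R i) \<le> \<bar>a\<bar> + \<bar>b\<bar>"
    using norm_triangle_ineq4[of "a *\<^sub>R 1" "b *\<^sub>R i"] by (simp add: ni)
  ultimately have 1: "a * a + b * b \<le> norm (a *\<^sub>R 1 + b *\<^sub>R i) * (\<bar>a\<bar> + \<bar>b\<bar>)"
    by (metis mult_left_mono norm_ge_zero)
  have "0 \<le> (\<bar>a\<bar> - \<bar>b\<bar>) * (\<bar>a\<bar> - \<bar>b\<bar>)"
    by simp
  then have "(\<bar>a\<bar> + \<bar>b\<bar>) * (\<bar>a\<bar> + \<bar>b\<bar>) \<le> 2 * (a * a + b * b)"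
    by (simp add: algebra_simps)
  also have "\<dots> \<le> 2 * (norm (a *\<^sub>R 1 + b *\<^sub>R i) * (\<bar>a\<bar> + \<bar>b\<bar>))"
    using 1 by (rule mult_left_mono) simp
  finally have "(\<bar>a\<bar> + \<bar>b\<bar>) * (\<bar>a\<bar> + \<bar>b\<bar>) \<le> (2 * norm (a *\<^sub>R 1 + b *\<^sub>R i)) * (\<bar>a\<bar> + \<bar>b\<bar>)"
    by (simp only: mult.assoc)
  moreover have "0 < \<bar>a\<bar> + \<bar>b\<bar>"
    using False by linarith
  ultimately show ?thesis
    by (rule mult_right_le_imp_le)
qed simp

text \<open>Both alternatives of the class are put into one shape: real coordinates that are Lipschitz
  for the norm. In the real case the second coordinate is constantly \<open>0\<close>.\<close>

lemma real_or_complex_coordinates: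
  obtains f g :: "'k::real_or_complex \<Rightarrow> real" and e :: 'k
  where "\<And>z. z = f z *\<^sub>R 1 + g z *\<^sub>R e"
    and "\<And>z w. \<bar>f z - f w\<bar> \<le> 2 * norm (z - w)" and "\<And>z w. \<bar>g z - g w\<bar> \<le> 2 * norm (z - w)"
  using real_or_complex[where ?'a = 'k]
proof
  assume "\<forall>z::'k. \<exists>a. z = a *\<^sub>R 1"
  then obtain f :: "'k \<Rightarrow> real" where f: "z = f z *\<^sub>R 1" for z
    by metis
  have "\<bar>f z - f w\<bar> = norm (z - w)" for z w
  proof -
    have "z - w = (f z - f w) *\<^sub>R 1"
      using f[of z] f[of w] by (metis scaleR_left_diff_distrib)
    then show ?thesis
      by simp
  qed
  with f show ?thesis
    by (intro that[of f "\<lambda>_. 0" 1]) auto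
next
  assume "\<exists>i::'k. i * i = -1 \<and> (\<forall>z. \<exists>a b. z = a *\<^sub>R 1 + b *\<^sub>R i)"
  then obtain i :: 'k and f g :: "'k \<Rightarrow> real"
    where i: "i * i = -1" and fg: "z = f z *\<^sub>R 1 + g z *\<^sub>R i" for z
    by metis
  have "\<bar>f z - f w\<bar> + \<bar>g z - g w\<bar> \<le> 2 * norm (z - w)" for z w
  proof -
    have "z - w = (f z *\<^sub>R 1 + g z *\<^sub>R i) - (f w *\<^sub>R 1 + g w *\<^sub>R i)"
      using fg[of z] fg[of w] by metis
    then have "z - w = (f z - f w) *\<^sub>R 1 + (g z - g w) *\<^sub>R i"
      by (simp add: algebra_simps)
    then show ?thesis
      using abs_add_abs_le_norm[OF i, of "f z - f w" "g z - g w"] by metis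
  qed
  then have "\<bar>f z - f w\<bar> \<le> 2 * norm (z - w)" "\<bar>g z - g w\<bar> \<le> 2 * norm (z - w)" for z w
    by (smt (verit, best))+
  with fg show ?thesis
    by (intro that[of f g i]) auto
qed

instance real_or_complex \<subseteq> complete_space
proof
  fix X :: "nat \<Rightarrow> 'a"
  assume X: "Cauchy X"
  obtain f g :: "'a \<Rightarrow> real" and e :: 'a
    where rep: "\<And>z. z = f z *\<^sub>R 1 + g z *\<^sub>R e"
      and f: "\<And>z w. \<bar>f z - f w\<bar> \<le> 2 * norm (z - w)"
      and g: "\<And>z w. \<bar>g z - g w\<bar> \<le> 2 * norm (z - w)"
    by (rule real_or_complex_coordinates) (rule that)
  have "Cauchy (\<lambda>k. h (X k))" if h: "\<And>z w. \<bar>h z - h w\<bar> \<le> 2 * norm (z - w)" for h :: "'a \<Rightarrow> real"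
  proof (rule CauchyI)
    fix d :: real assume "0 < d"
    then obtain M where "\<forall>m\<ge>M. \<forall>n\<ge>M. norm (X m - X n) < d / 2"
      using X[unfolded Cauchy_iff] by (meson half_gt_zero)
    then show "\<exists>M. \<forall>m\<ge>M. \<forall>n\<ge>M. norm (h (X m) - h (X n)) < d"
      using h by (intro exI[of _ M]) (smt (verit, best) field_sum_of_halves real_norm_def)
  qed
  from this[of f] this[of g] f g obtain a b where
    "(\<lambda>k. f (X k)) \<longlonglongrightarrow> a" "(\<lambda>k. g (X k)) \<longlonglongrightarrow> b"
    by (metis real_Cauchy_convergent convergentD)
  then have "(\<lambda>k. f (X k) *\<^sub>R 1 + g (X k) *\<^sub>R e) \<longlonglongrightarrow> a *\<^sub>R 1 + b *\<^sub>R e"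
    by (intro tendsto_intros)
  then show "convergent X"
    using rep by (metis (no_types, lifting) convergentI ext)
qed


section \<open>Coordinates are continuous for every norm\<close>

lemma norm_le_sum_coordinates:
  fixes \<nu> :: "('i \<Rightarrow> 'k::real_normed_field) \<Rightarrow> real"
  assumes scale: "\<And>c f. \<nu> (\<lambda>i. c * f i) = norm c * \<nu> f"
    and triangle: "\<And>f g. \<nu> (\<lambda>i. f i + g i) \<le> \<nu> f + \<nu> g"
    and "finite I" "\<And>i. i \<notin> I \<Longrightarrow> f i = 0"
  shows "\<nu> f \<le> (\<Sum>j\<in>I. norm (f j) * \<nu> (\<lambda>i. if i = j then 1 else 0))"
  using assms(3,4)
proof (induction I arbitrary: f)
  case empty
  then have "f = (\<lambda>i. 0 * f i)"
    by auto
  then show ?case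
    using scale[of 0 f] by simp
next
  case (insert z I)
  let ?e = "\<lambda>i. if i = z then 1 else (0::'k)"
  let ?g = "\<lambda>i. if i = z then 0 else f i"
  have "\<nu> f = \<nu> (\<lambda>i. f z * ?e i + ?g i)"
    by (rule arg_cong[of _ _ \<nu>]) auto
  also have "\<dots> \<le> norm (f z) * \<nu> ?e + \<nu> ?g"
    using triangle[of "\<lambda>i. f z * ?e i" ?g] by (simp only: scale)
  also have "\<nu> ?g \<le> (\<Sum>j\<in>I. norm (?g j) * \<nu> (\<lambda>i. if i = j then 1 else 0))"
    using insert.prems by (intro insert.IH) auto
  also have "\<dots> = (\<Sum>j\<in>I. norm (f j) * \<nu> (\<lambda>i. if i = j then 1 else 0))"
    using insert.hyps by (intro sum.cong) auto
  finally show ?case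
    using insert.hyps by simp
qed

text \<open>This is the part of the equivalence of norms on \<open>K\<^sup>I\<close> that is used, by induction on \<open>I\<close>. The
  coordinates in \<open>I\<close> are bounded by the norm, hence \<open>K\<^sup>I\<close> is complete and so closed in \<open>K\<^bsup>I \<union> {z}\<^esup>\<close>;
  thus the unit vector at \<open>z\<close> has a positive distance \<open>\<delta>\<close> from it, which bounds the new coordinate.\<close>

lemma norm_bounds_coordinates:
  fixes \<nu> :: "('i \<Rightarrow> 'k::{real_normed_field, complete_space}) \<Rightarrow> real"
  assumes nonneg: "\<And>f. 0 \<le> \<nu> f"
    and scale: "\<And>c f. \<nu> (\<lambda>i. c * f i) = norm c * \<nu> f"
    and triangle: "\<And>f g. \<nu> (\<lambda>i. f i + g i) \<le> \<nu> f + \<nu> g"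
    and "finite I"
    and "\<And>f. (\<And>i. i \<notin> I \<Longrightarrow> f i = 0) \<Longrightarrow> \<nu> f = 0 \<Longrightarrow> \<forall>i\<in>I. f i = 0"
  shows "\<exists>C\<ge>0. \<forall>f. (\<forall>i. i \<notin> I \<longrightarrow> f i = 0) \<longrightarrow> (\<forall>i\<in>I. norm (f i) \<le> C * \<nu> f)"
  using assms(4,5)
proof (induction I)
  case empty
  show ?case by (intro exI[of _ 0]) auto
next
  case (insert z I)
  have neg: "\<nu> (\<lambda>i. - f i) = \<nu> f" for f
    using scale[of "-1" f] by simp
  have "\<forall>i\<in>I. f i = 0" if "\<And>i. i \<notin> I \<Longrightarrow> f i = 0" "\<nu> f = 0" for f
    using insert.prems[of f] that by auto
  then obtain C where C0: "0 \<le> C"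
    and C: "\<And>f i. (\<And>i. i \<notin> I \<Longrightarrow> f i = 0) \<Longrightarrow> i \<in> I \<Longrightarrow> norm (f i) \<le> C * \<nu> f"
    using insert.IH by blast
  define e :: "'i \<Rightarrow> 'k" where "e = (\<lambda>i. if i = z then 1 else 0)"
  have "\<exists>\<delta>>0. \<forall>w. (\<forall>i. i \<notin> I \<longrightarrow> w i = 0) \<longrightarrow> \<delta> \<le> \<nu> (\<lambda>i. e i + w i)"
  proof (rule ccontr)
    assume neg_thesis: "\<not> ?thesis"
    have "\<exists>w. (\<forall>i. i \<notin> I \<longrightarrow> w i = 0) \<and> \<nu> (\<lambda>i. e i + w i) < inverse (real (Suc k))" for k
      using neg_thesis by (metis inverse_positive_iff_positive linorder_not_le of_nat_0_less_iff zero_less_Suc)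
    then obtain w where w0: "\<And>k i. i \<notin> I \<Longrightarrow> w k i = 0"
      and w: "\<And>k. \<nu> (\<lambda>i. e i + w k i) < inverse (real (Suc k))"
      by metis
    have lim: "(\<lambda>k. inverse (real (Suc k))) \<longlonglongrightarrow> 0"
      by (rule LIMSEQ_inverse_real_of_nat)
    have "Cauchy (\<lambda>k. w k i)" if i: "i \<in> I" for i
    proof (rule CauchyI)
      fix d :: real assume d: "0 < d"
      have "(\<lambda>k. 2 * C * inverse (real (Suc k))) \<longlonglongrightarrow> 0"
        using tendsto_mult_left[OF lim, of "2 * C"] by simp
      then have "\<forall>\<^sub>F k in sequentially. 2 * C * inverse (real (Suc k)) < d"
        using d by (rule order_tendstoD)
      then obtain M where M: "2 * C * inverse (real (Suc M)) < d"
        by (auto simp: eventually_sequentially)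
      have "norm (w p i - w q i) < d" if "p \<ge> M" "q \<ge> M" for p q
      proof -
        have le: "\<nu> (\<lambda>i. e i + w k i) \<le> inverse (real (Suc M))" if "k \<ge> M" for k
          using w[of k] that by (meson le_imp_inverse_le less_imp_le of_nat_0_less_iff of_nat_le_iff
              order_trans Suc_le_mono zero_less_Suc)
        have "norm (w p i - w q i) \<le> C * \<nu> (\<lambda>i. w p i - w q i)"
          using C[of "\<lambda>i. w p i - w q i" i] w0 i by simp
        also have "(\<lambda>i. w p i - w q i) = (\<lambda>i. (e i + w p i) + - (e i + w q i))"
          by auto
        also have "C * \<nu> \<dots> \<le> C * (\<nu> (\<lambda>i. e i + w p i) + \<nu> (\<lambda>i. - (e i + w q i)))"
          using C0 by (intro mult_left_mono triangle)
        also have "\<dots> \<le> C * (inverse (real (Suc M)) + inverse (real (Suc M)))"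
          unfolding neg using C0 le that by (intro mult_left_mono add_mono) auto
        finally show ?thesis
          using M by (simp only: distrib_left mult_2) (simp add: algebra_simps)
      qed
      then show "\<exists>M. \<forall>m\<ge>M. \<forall>n\<ge>M. norm (w m i - w n i) < d"
        by blast
    qed
    then have "\<forall>i\<in>I. \<exists>l. (\<lambda>k. w k i) \<longlonglongrightarrow> l"
      by (meson Cauchy_convergent convergentD)
    then obtain L' where L': "\<And>i. i \<in> I \<Longrightarrow> (\<lambda>k. w k i) \<longlonglongrightarrow> L' i"
      by metis
    define L where "L = (\<lambda>i. if i \<in> I then L' i else 0)"
    have L0: "L i = 0" if "i \<notin> I" for i
      using that by (simp add: L_def)
    have L: "(\<lambda>k. norm (L i - w k i)) \<longlonglongrightarrow> 0" if "i \<in> I" for i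
      using tendsto_norm[OF tendsto_diff[OF tendsto_const L'[OF that], of "L i"]] that
      by (simp add: L_def)
    let ?b = "\<lambda>k. inverse (real (Suc k)) +
      (\<Sum>j\<in>I. norm (L j - w k j) * \<nu> (\<lambda>i. if i = j then 1 else 0))"
    have "\<nu> (\<lambda>i. e i + L i) \<le> ?b k" for k
    proof -
      have "\<nu> (\<lambda>i. e i + L i) = \<nu> (\<lambda>i. (e i + w k i) + (L i - w k i))"
        by (rule arg_cong[of _ _ \<nu>]) auto
      also have "\<dots> \<le> \<nu> (\<lambda>i. e i + w k i) + \<nu> (\<lambda>i. L i - w k i)"
        by (rule triangle)
      also have "\<nu> (\<lambda>i. L i - w k i) \<le> (\<Sum>j\<in>I. norm (L j - w k j) * \<nu> (\<lambda>i. if i = j then 1 else 0))"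
        using w0 L0 insert.hyps(1) by (intro norm_le_sum_coordinates scale triangle) auto
      finally show ?thesis
        using w[of k] by linarith
    qed
    moreover have "?b \<longlonglongrightarrow> 0 + (\<Sum>j\<in>I. 0 * \<nu> (\<lambda>i. if i = j then 1 else 0))"
      by (intro tendsto_add tendsto_sum tendsto_mult L lim tendsto_const)
    ultimately have "\<nu> (\<lambda>i. e i + L i) \<le> 0"
      using LIMSEQ_le_const by fastforce
    then have "\<nu> (\<lambda>i. e i + L i) = 0"
      using nonneg by (intro antisym)
    then have "\<forall>i\<in>insert z I. e i + L i = 0"
      by (intro insert.prems) (auto simp: e_def L0)
    then show False
      using L0[OF insert.hyps(2)] by (simp add: e_def)
  qed
  then obtain \<delta> where \<delta>: "0 < \<delta>"
    and dist: "\<And>w. (\<And>i. i \<notin> I \<Longrightarrow> w i = 0) \<Longrightarrow> \<delta> \<le> \<nu> (\<lambda>i. e i + w i)"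
    by blast
  define D where "D = C * (1 + \<nu> e / \<delta>)"
  have z_bound: "norm (f z) \<le> \<nu> f / \<delta>" if f: "\<forall>i. i \<notin> insert z I \<longrightarrow> f i = 0" for f
  proof (cases "f z = 0")
    case True
    then show ?thesis
      using nonneg[of f] \<delta> by simp
  next
    case False
    let ?w = "\<lambda>i. if i = z then 0 else f i / f z"
    have "\<nu> f = \<nu> (\<lambda>i. f z * (e i + ?w i))"
      using False by (intro arg_cong[of _ _ \<nu>]) (auto simp: e_def)
    also have "\<dots> = norm (f z) * \<nu> (\<lambda>i. e i + ?w i)"
      by (rule scale)
    also have "\<dots> \<ge> norm (f z) * \<delta>"
      using f by (intro mult_left_mono dist) auto
    finally show ?thesis
      using \<delta> by (simp add: field_simps)
  qed
  have I_bound: "norm (f i) \<le> D * \<nu> f"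
    if f: "\<forall>i. i \<notin> insert z I \<longrightarrow> f i = 0" and i: "i \<in> I" for f i
  proof -
    let ?w = "\<lambda>i. if i = z then 0 else f i"
    have "norm (?w i) \<le> C * \<nu> ?w"
      using f i by (intro C) auto
    then have "norm (f i) \<le> C * \<nu> ?w"
      using i insert.hyps(2) by (auto split: if_splits)
    also have "?w = (\<lambda>i. f i + (- f z) * e i)"
      by (auto simp: e_def)
    also have "C * \<nu> \<dots> \<le> C * (\<nu> f + norm (f z) * \<nu> e)"
      using triangle[of f "\<lambda>i. (- f z) * e i"] C0 unfolding scale
      by (intro mult_left_mono) auto
    also have "\<dots> \<le> C * (\<nu> f + (\<nu> f / \<delta>) * \<nu> e)"
      using C0 nonneg z_bound[OF f] by (intro mult_left_mono add_left_mono mult_right_mono) auto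
    also have "\<dots> = D * \<nu> f"
      by (simp add: D_def algebra_simps)
    finally show ?thesis .
  qed
  have "0 \<le> D"
    using C0 nonneg \<delta> by (simp add: D_def)
  have "norm (f i) \<le> (D + 1 / \<delta>) * \<nu> f"
    if f: "\<forall>i. i \<notin> insert z I \<longrightarrow> f i = 0" and i: "i \<in> insert z I" for f i
  proof -
    have "norm (f i) \<le> D * \<nu> f \<or> norm (f i) \<le> 1 / \<delta> * \<nu> f"
      using z_bound[OF f] I_bound[OF f] i by auto
    moreover have "0 \<le> D * \<nu> f" "0 \<le> 1 / \<delta> * \<nu> f"
      using \<open>0 \<le> D\<close> nonneg[of f] \<delta> by auto
    ultimately show ?thesis
      by (auto simp: distrib_right)
  qed
  then show ?case
    using \<open>0 \<le> D\<close> \<delta> by (intro exI[of _ "D + 1 / \<delta>"]) auto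
qed

section \<open>Extending isometries\<close>

locale symmetric_form = finite_dimensional_vector_space scale Basis
  for scale :: "'k::field_char_0 \<Rightarrow> 'v::ab_group_add \<Rightarrow> 'v" (infixr "*s" 75)
    and Basis :: "'v set" +
  fixes form :: "'v \<Rightarrow> 'v \<Rightarrow> 'k"
  assumes form_add_left: "form (x + y) z = form x z + form y z"
    and form_scale_left: "form (c *s x) z = c * form x z"
    and form_commute: "form x y = form y x"
begin

lemma form_add_right: "form z (x + y) = form z x + form z y"
  by (metis form_add_left form_commute)

lemma form_scale_right: "form z (c *s x) = c * form z x"
  by (metis form_scale_left form_commute)

lemma form_zero_left [simp]: "form 0 z = 0"
  using form_scale_left[of 0 0 z] by simp

lemma form_zero_right [simp]: "form z 0 = 0"
  using form_zero_left[of z] by (simp only: form_commute)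

lemma form_minus_left: "form (- x) z = - form x z"
  using form_add_left[of x "- x" z] by (simp add: eq_neg_iff_add_eq_0 add.commute)

lemma form_minus_right: "form z (- x) = - form z x"
  by (metis form_minus_left form_commute)

lemma form_diff_left: "form (x - y) z = form x z - form y z"
  using form_add_left[of x "- y" z] by (simp add: form_minus_left)

lemma form_diff_right: "form z (x - y) = form z x - form z y"
  by (metis form_diff_left form_commute)

lemma form_sum_left: "form (\<Sum>i\<in>I. f i) z = (\<Sum>i\<in>I. form (f i) z)"
  by (induction I rule: infinite_finite_induct) (auto simp: form_add_left)

lemma form_sum_right: "form z (\<Sum>i\<in>I. f i) = (\<Sum>i\<in>I. form z (f i))"
  by (induction I rule: infinite_finite_induct) (auto simp: form_add_right)

lemmas form_simps = form_add_left form_add_right form_scale_left form_scale_right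
  form_diff_left form_diff_right form_minus_left form_minus_right

lemma orthogonal_mapsI:
  assumes "\<And>x y. g (x + y) = g x + g y" "\<And>c x. g (c *s x) = c *s g x"
    and "bij g" "\<And>x y. form (g x) (g y) = form x y"
  shows "g \<in> orthogonal_maps scale form"
  using assms vector_space_axioms unfolding orthogonal_maps_def Vector_Spaces.linear_iff by blast

lemma
  assumes "g \<in> orthogonal_maps scale form"
  shows orthogonal_maps_add: "g (x + y) = g x + g y"
    and orthogonal_maps_scale: "g (c *s x) = c *s g x"
    and orthogonal_maps_bij: "bij g"
    and orthogonal_maps_form: "form (g x) (g y) = form x y"
  using assms unfolding orthogonal_maps_def Vector_Spaces.linear_iff by blast+

lemma orthogonal_maps_sum:
  assumes "g \<in> orthogonal_maps scale form"
  shows "g (\<Sum>i\<in>I. f i) = (\<Sum>i\<in>I. g (f i))"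
proof -
  have "g 0 = 0"
    using orthogonal_maps_scale[OF assms, of 0 0] by simp
  then show ?thesis
    by (induction I rule: infinite_finite_induct) (auto simp: orthogonal_maps_add[OF assms])
qed

lemma orthogonal_maps_comp:
  assumes "g \<in> orthogonal_maps scale form" "h \<in> orthogonal_maps scale form"
  shows "g \<circ> h \<in> orthogonal_maps scale form"
  using assms
  by (intro orthogonal_mapsI)
    (auto simp: orthogonal_maps_add orthogonal_maps_scale orthogonal_maps_form
      intro: bij_comp orthogonal_maps_bij)

lemma id_in_orthogonal_maps: "id \<in> orthogonal_maps scale form"
  by (intro orthogonal_mapsI) auto

definition reflection :: "'v \<Rightarrow> 'v \<Rightarrow> 'v" where
  "reflection a x = x - (2 * form a x / form a a) *s a"

lemma reflection_in_orthogonal_maps: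
  assumes a: "form a a \<noteq> 0"
  shows "reflection a \<in> orthogonal_maps scale form"
proof (rule orthogonal_mapsI)
  show "reflection a (x + y) = reflection a x + reflection a y" for x y
    by (simp add: reflection_def form_simps distrib_left add_divide_distrib scale_left_distrib)
  show "reflection a (c *s x) = c *s reflection a x" for c x
    by (simp add: reflection_def form_simps scale_right_diff_distrib mult.left_commute)
  have "reflection a (reflection a x) = x" for x
  proof -
    have "form a (reflection a x) = - form a x"
      using a by (simp add: reflection_def form_simps)
    then have "reflection a (reflection a x) = reflection a x + (2 * form a x / form a a) *s a"
      by (simp add: reflection_def[of a "reflection a x"])
    then show ?thesis
      by (simp add: reflection_def)
  qed
  then show "bij (reflection a)"
    by (intro o_bij[of "reflection a"]) auto
  show "form (reflection a x) (reflection a y) = form x y" for x y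
    using a by (simp add: reflection_def form_simps form_commute[of x a] field_simps)
qed

lemma reflection_orthogonal: "form a x = 0 \<Longrightarrow> reflection a x = x"
  by (simp add: reflection_def)

lemma reflection_diff:
  assumes "form x x = form y y" "form (x - y) (x - y) \<noteq> 0"
  shows "reflection (x - y) x = y"
proof -
  have "2 * form (x - y) x = form (x - y) (x - y)"
    using assms(1) by (simp add: form_simps form_commute[of y x])
  then show ?thesis
    using assms(2) by (simp add: reflection_def)
qed

text \<open>One of \<open>x - y\<close> and \<open>x + y\<close> is anisotropic, because \<open>\<langle>x - y, x - y\<rangle> + \<langle>x + y, x + y\<rangle> = 4 \<langle>x, x\<rangle>\<close>.
  In the first case the reflection along \<open>x - y\<close> maps \<open>x\<close> to \<open>y\<close>; in the second the reflection
  along \<open>x + y\<close> maps \<open>x\<close> to \<open>-y\<close>, which the reflection along \<open>y\<close> sends to \<open>y\<close>. All the vectors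
  reflected along are combinations of \<open>x\<close> and \<open>y\<close>.\<close>

lemma anisotropic_transitive:
  assumes eq: "form x x = form y y" and nz: "form x x \<noteq> 0"
  obtains g where "g \<in> orthogonal_maps scale form" "g x = y"
    "\<And>z. form x z = 0 \<Longrightarrow> form y z = 0 \<Longrightarrow> g z = z"
proof (cases "form (x - y) (x - y) = 0")
  case False
  then show ?thesis
    using eq by (intro that[of "reflection (x - y)"])
      (auto simp: reflection_in_orthogonal_maps reflection_diff reflection_orthogonal form_simps)
next
  case True
  have "form (x - - y) (x - - y) + form (x - y) (x - y) = 4 * form x x"
    using eq by (simp add: form_simps form_commute[of y x])
  then have sum: "form (x - - y) (x - - y) \<noteq> 0"
    using True nz by auto
  have "reflection (x - - y) x = - y"
    using eq sum by (intro reflection_diff) (simp_all add: form_simps)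
  moreover have "reflection y (- y) = y"
  proof -
    have "2 *s y = y + y"
      using scale_left_distrib[of 1 1 y] by simp
    then show ?thesis
      using nz eq by (simp add: reflection_def form_simps)
  qed
  ultimately show ?thesis
    using sum nz eq by (intro that[of "reflection y \<circ> reflection (x - - y)"])
      (auto simp: reflection_orthogonal form_simps simp del: diff_minus_eq_add
        intro!: orthogonal_maps_comp reflection_in_orthogonal_maps)
qed

text \<open>The map is built one vector at a time. If \<open>g\<close> already maps each earlier \<open>x\<close> to its \<open>y\<close>, the
  correction that moves \<open>g x'\<close> to \<open>y'\<close> is trivial on the vectors orthogonal to both, and the earlier
  \<open>y\<close> are among these.\<close>

lemma orthogonal_families_congruent:
  assumes "finite T"
    and "\<And>p. p \<in> T \<Longrightarrow> form (fst p) (fst p) \<noteq> 0"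
    and "\<And>p q. p \<in> T \<Longrightarrow> q \<in> T \<Longrightarrow> form (fst p) (fst q) = form (snd p) (snd q)"
    and "\<And>p q. p \<in> T \<Longrightarrow> q \<in> T \<Longrightarrow> p \<noteq> q \<Longrightarrow> form (fst p) (fst q) = 0"
  shows "\<exists>g \<in> orthogonal_maps scale form. \<forall>p\<in>T. g (fst p) = snd p"
  using assms
proof (induction T)
  case empty
  show ?case
    using id_in_orthogonal_maps by auto
next
  case (insert q T)
  have "\<exists>g \<in> orthogonal_maps scale form. \<forall>p\<in>T. g (fst p) = snd p"
    using insert.prems by (intro insert.IH) simp_all
  then obtain g where g: "g \<in> orthogonal_maps scale form" and gT: "\<forall>p\<in>T. g (fst p) = snd p"
    by blast
  have 1: "form (g (fst q)) (g (fst q)) = form (snd q) (snd q)"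
    and 2: "form (g (fst q)) (g (fst q)) \<noteq> 0"
    using insert.prems(1)[of q] insert.prems(2)[of q q] by (simp_all add: orthogonal_maps_form[OF g])
  obtain h where h: "h \<in> orthogonal_maps scale form" "h (g (fst q)) = snd q"
    and fixes_orth: "\<And>z. form (g (fst q)) z = 0 \<Longrightarrow> form (snd q) z = 0 \<Longrightarrow> h z = z"
    by (rule anisotropic_transitive[OF 1 2]) (rule that)
  have "h (g (fst p)) = snd p" if p: "p \<in> T" for p
  proof -
    have ortho: "form (fst q) (fst p) = 0"
      using insert.prems(3)[of q p] insert.hyps(2) p by auto
    have "h (snd p) = snd p"
    proof (rule fixes_orth)
      show "form (g (fst q)) (snd p) = 0"
        using ortho gT p by (metis orthogonal_maps_form[OF g])
      show "form (snd q) (snd p) = 0"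
        using ortho insert.prems(2)[of q p] p by simp
    qed
    then show ?thesis
      using gT p by simp
  qed
  then show ?case
    using h g by (intro bexI[of _ "h \<circ> g"] orthogonal_maps_comp) auto
qed

lemma orthogonal_family_bound:
  assumes "finite T"
    and nz: "\<And>p. p \<in> T \<Longrightarrow> form (fst p) (fst p) \<noteq> 0"
    and ortho: "\<And>p q. p \<in> T \<Longrightarrow> q \<in> T \<Longrightarrow> p \<noteq> q \<Longrightarrow> form (fst p) (fst q) = 0"
  shows "card T \<le> dim (UNIV :: 'v set)"
proof -
  have inj: "inj_on fst T"
    using nz ortho by (metis inj_onI)
  have "independent (fst ` T)"
  proof
    assume "dependent (fst ` T)"
    then obtain u where u: "\<exists>v\<in>fst ` T. u v \<noteq> 0" and "(\<Sum>v\<in>fst ` T. u v *s v) = 0"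
      using assms(1) by (auto simp: dependent_finite)
    then have sum: "(\<Sum>q\<in>T. u (fst q) *s fst q) = 0"
      by (simp add: sum.reindex[OF inj])
    have "u (fst p) = 0" if p: "p \<in> T" for p
    proof -
      have "0 = form (fst p) (\<Sum>q\<in>T. u (fst q) *s fst q)"
        using sum by simp
      also have "\<dots> = (\<Sum>q\<in>T. if q = p then u (fst p) * form (fst p) (fst p) else 0)"
        unfolding form_sum_right form_scale_right using p ortho by (intro sum.cong) auto
      also have "\<dots> = u (fst p) * form (fst p) (fst p)"
        using p assms(1) by simp
      finally show ?thesis
        using nz[OF p] by simp
    qed
    then show False
      using u by auto
  qed
  then have "card (fst ` T) \<le> dim (UNIV :: 'v set)"
    by (intro independent_card_le_dim) auto
  then show ?thesis
    by (simp add: card_image[OF inj])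
qed

text \<open>This is Witt's extension theorem for an isometry between nondegenerate subspaces, where the
  isometry is given by its graph \<open>S\<close>. Thus nothing has to be checked for well-definedness: that \<open>S\<close> is
  a graph follows from nondegeneracy, as a pair \<open>(0, y)\<close> in \<open>S\<close> is orthogonal to \<open>S\<close>. Let \<open>T\<close> be a maximal
  orthogonal family of anisotropic pairs of \<open>S\<close>. What remains of a pair of \<open>S\<close> after subtracting its
  projection to \<open>T\<close> is orthogonal to \<open>T\<close>. By maximality and polarization the form vanishes on such
  remainders, so they are orthogonal to \<open>S\<close>, hence zero.
  So \<open>T\<close> spans \<open>S\<close>, and reflections do the rest.\<close>

theorem nondegenerate_isometry_extends:
  assumes add: "\<And>p q. p \<in> S \<Longrightarrow> q \<in> S \<Longrightarrow> (fst p + fst q, snd p + snd q) \<in> S"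
    and scale: "\<And>c p. p \<in> S \<Longrightarrow> (c *s fst p, c *s snd p) \<in> S"
    and isometric: "\<And>p q. p \<in> S \<Longrightarrow> q \<in> S \<Longrightarrow> form (fst p) (fst q) = form (snd p) (snd q)"
    and nondegenerate: "\<And>p. p \<in> S \<Longrightarrow> (\<And>q. q \<in> S \<Longrightarrow> form (fst p) (fst q) = 0) \<Longrightarrow> p = (0, 0)"
  shows "\<exists>g \<in> orthogonal_maps scale form. \<forall>p\<in>S. g (fst p) = snd p"
proof -
  define orthogonal_family where "orthogonal_family T \<longleftrightarrow> finite T \<and> T \<subseteq> S \<and>
      (\<forall>p\<in>T. form (fst p) (fst p) \<noteq> 0) \<and> (\<forall>p\<in>T. \<forall>q\<in>T. p \<noteq> q \<longrightarrow> form (fst p) (fst q) = 0)" for T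
  have "orthogonal_family {}"
    by (simp add: orthogonal_family_def)
  moreover have "\<forall>T. orthogonal_family T \<longrightarrow> card T < Suc (dim (UNIV :: 'v set))"
    by (auto simp: orthogonal_family_def less_Suc_eq_le simp del: dim_UNIV
        intro!: orthogonal_family_bound)
  ultimately obtain T where T: "orthogonal_family T"
    and max: "\<And>T'. orthogonal_family T' \<Longrightarrow> card T' \<le> card T"
    using ex_has_greatest_nat[of orthogonal_family "{}" card] by blast
  have fin: "finite T" and TS: "T \<subseteq> S" and nz: "\<And>p. p \<in> T \<Longrightarrow> form (fst p) (fst p) \<noteq> 0"
    and ortho: "\<And>p q. p \<in> T \<Longrightarrow> q \<in> T \<Longrightarrow> p \<noteq> q \<Longrightarrow> form (fst p) (fst q) = 0"
    using T by (auto simp: orthogonal_family_def)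
  define R where "R = {p\<in>S. \<forall>t\<in>T. form (fst p) (fst t) = 0}"
  have isotropic: "form (fst p) (fst p) = 0" if p: "p \<in> R" for p
  proof (rule ccontr)
    assume p_nz: "form (fst p) (fst p) \<noteq> 0"
    have "p \<notin> T"
      using p p_nz by (auto simp: R_def)
    moreover have "orthogonal_family (insert p T)"
      using T p p_nz form_commute by (auto simp: orthogonal_family_def R_def)
    ultimately show False
      using max[of "insert p T"] fin by simp
  qed
  have R_orthogonal: "form (fst p) (fst q) = 0" if p: "p \<in> R" and q: "q \<in> R" for p q
  proof -
    have "(fst p + fst q, snd p + snd q) \<in> R"
      using p q add by (auto simp: R_def form_simps)
    from isotropic[OF this] isotropic[OF p] isotropic[OF q]
    have "2 * form (fst p) (fst q) = 0"
      by (simp add: form_simps form_commute[of "fst q" "fst p"])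
    then show ?thesis
      by simp
  qed
  define coeff where "coeff p t = form (fst p) (fst t) / form (fst t) (fst t)" for p t :: "'v \<times> 'v"
  have sum_in_S: "(\<Sum>t\<in>T'. c t *s fst t, \<Sum>t\<in>T'. c t *s snd t) \<in> S"
    if "T' \<subseteq> T" "p \<in> S" for T' p and c :: "'v \<times> 'v \<Rightarrow> 'k"
  proof -
    have "finite T'"
      using that fin finite_subset by blast
    then show ?thesis
      using that(1)
    proof (induction T')
      case empty
      show ?case
        using scale[OF that(2), of 0] by simp
    next
      case (insert t T')
      then show ?case
        using add[OF scale[of t "c t"]] TS by auto
    qed
  qed
  define remainder where "remainder p =
      (fst p - (\<Sum>t\<in>T. coeff p t *s fst t), snd p - (\<Sum>t\<in>T. coeff p t *s snd t))" for p
  have remainder_R: "remainder p \<in> R" if p: "p \<in> S" for p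
  proof -
    have "remainder p \<in> S"
      using add[OF p sum_in_S[OF subset_refl p, of "\<lambda>t. - coeff p t"]]
      by (simp add: remainder_def sum_negf)
    moreover have "form (fst (remainder p)) (fst s) = 0" if s: "s \<in> T" for s
    proof -
      have "(\<Sum>t\<in>T. coeff p t * form (fst t) (fst s)) =
          (\<Sum>t\<in>T. if t = s then coeff p s * form (fst s) (fst s) else 0)"
        using ortho s by (intro sum.cong) auto
      also have "\<dots> = form (fst p) (fst s)"
        using s fin nz[OF s] by (simp add: coeff_def)
      finally show ?thesis
        by (simp add: remainder_def form_simps form_sum_left)
    qed
    ultimately show ?thesis
      by (simp add: R_def)
  qed
  have remainder_zero: "remainder p = (0, 0)" if p: "p \<in> S" for p
  proof (rule nondegenerate)
    show "remainder p \<in> S"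
      using remainder_R[OF p] by (simp add: R_def)
    fix q assume q: "q \<in> S"
    have "form (fst (remainder p)) (fst q) =
        form (fst (remainder p)) (fst (remainder q) + (\<Sum>t\<in>T. coeff q t *s fst t))"
      by (simp add: remainder_def)
    also have "\<dots> = (\<Sum>t\<in>T. coeff q t * form (fst (remainder p)) (fst t))"
      using R_orthogonal[OF remainder_R[OF p] remainder_R[OF q]]
      by (simp add: form_add_right form_sum_right form_scale_right)
    also have "\<dots> = 0"
      using remainder_R[OF p] by (simp add: R_def)
    finally show "form (fst (remainder p)) (fst q) = 0" .
  qed
  have "\<exists>g \<in> orthogonal_maps scale form. \<forall>p\<in>T. g (fst p) = snd p"
    by (rule orthogonal_families_congruent[OF fin nz _ ortho]) (use TS isometric in blast)+
  then obtain g where g: "g \<in> orthogonal_maps scale form" and gT: "\<And>p. p \<in> T \<Longrightarrow> g (fst p) = snd p"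
    by blast
  have "g (fst p) = snd p" if p: "p \<in> S" for p
  proof -
    have "g (fst p) = g (\<Sum>t\<in>T. coeff p t *s fst t)"
      using remainder_zero[OF p] by (simp add: remainder_def)
    also have "\<dots> = (\<Sum>t\<in>T. coeff p t *s snd t)"
      by (simp add: orthogonal_maps_sum[OF g] orthogonal_maps_scale[OF g] gT)
    also have "\<dots> = snd p"
      using remainder_zero[OF p] by (simp add: remainder_def)
    finally show ?thesis .
  qed
  with g show ?thesis
    by blast
qed


section \<open>Gram matrices of maximal rank\<close>

text \<open>The columns of the Gram matrix indexed by \<open>J\<close> are independent. A linear relation between the vectors
  \<open>v\<^sub>j\<close>, \<open>j \<in> J\<close>, is also one between these columns, so the \<open>v\<^sub>j\<close> are independent, and there are so many of
  them that they span all \<open>v\<^sub>i\<close>: either \<open>J = I\<close>, or they form a basis of the whole space. Thus a vector of the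
  radical is a combination of the \<open>v\<^sub>j\<close>, and being orthogonal to every \<open>v\<^sub>i\<close> it is again a relation between
  the columns.\<close>

lemma radical_trivial:
  fixes v :: "'i \<Rightarrow> 'v"
  assumes fin: "finite I" and JI: "J \<subseteq> I" and card: "card J = min (card I) (dim (UNIV :: 'v set))"
    and columns: "\<And>c j. (\<And>i. i \<in> I \<Longrightarrow> (\<Sum>j\<in>J. c j * form (v i) (v j)) = 0) \<Longrightarrow> j \<in> J \<Longrightarrow> c j = 0"
    and ortho: "\<And>i. i \<in> I \<Longrightarrow> form (\<Sum>i\<in>I. a i *s v i) (v i) = 0"
  shows "(\<Sum>i\<in>I. a i *s v i) = 0"
proof -
  have finJ: "finite J"
    using fin JI finite_subset by blast
  have relation: "c j = 0" if "(\<Sum>j\<in>J. c j *s v j) = 0" "j \<in> J" for c j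
  proof (rule columns)
    fix i assume "i \<in> I"
    have "(\<Sum>j\<in>J. c j * form (v i) (v j)) = form (v i) (\<Sum>j\<in>J. c j *s v j)"
      by (simp add: form_sum_right form_scale_right)
    then show "(\<Sum>j\<in>J. c j * form (v i) (v j)) = 0"
      using that by simp
  qed (fact that)
  \<comment> \<open>Equal vectors at different indices would also be a relation, with coefficients \<open>1\<close> and \<open>-1\<close>.\<close>
  have inj: "inj_on v J"
  proof (rule inj_onI, rule ccontr)
    fix j k assume j: "j \<in> J" and k: "k \<in> J" and eq: "v j = v k" and neq: "j \<noteq> k"
    let ?c = "\<lambda>i. if i = j then 1 else if i = k then - 1 else (0::'k)"
    have "(\<Sum>i\<in>J. ?c i *s v i) = (\<Sum>i\<in>J. (if i = j then v i else 0) - (if i = k then v i else 0))"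
      using neq by (intro sum.cong) auto
    also have "\<dots> = 0"
      using j k eq finJ by (simp add: sum_subtractf)
    finally have "?c j = 0"
      using j by (rule relation)
    then show False
      by simp
  qed
  have indep: "independent (v ` J)"
  proof
    assume "dependent (v ` J)"
    then obtain u where u: "\<exists>w\<in>v ` J. u w \<noteq> 0" and "(\<Sum>w\<in>v ` J. u w *s w) = 0"
      using finJ by (auto simp: dependent_finite)
    then have "(\<Sum>j\<in>J. u (v j) *s v j) = 0"
      by (simp add: sum.reindex[OF inj])
    from relation[OF this] u show False
      by auto
  qed
  have "(\<Sum>i\<in>I. a i *s v i) \<in> span (v ` J)"
  proof (cases "card J = card I")
    case True
    then have "J = I"
      using fin JI card_subset_eq by blast
    then show ?thesis
      by (intro span_sum span_scale span_base) auto
  next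
    case False
    then have "dim (UNIV :: 'v set) \<le> card (v ` J)"
      using card card_image[OF inj] by linarith
    then have "UNIV \<subseteq> span (v ` J)"
      using indep by (intro card_ge_dim_independent) auto
    then show ?thesis
      by blast
  qed
  then obtain u where "(\<Sum>i\<in>I. a i *s v i) = (\<Sum>w\<in>v ` J. u w *s w)"
    using finJ by (auto simp: span_finite)
  then have x: "(\<Sum>i\<in>I. a i *s v i) = (\<Sum>j\<in>J. u (v j) *s v j)"
    by (simp add: sum.reindex[OF inj])
  have "u (v j) = 0" if "j \<in> J" for j
  proof (rule columns[of "\<lambda>j. u (v j)"])
    fix i assume "i \<in> I"
    have "(\<Sum>j\<in>J. u (v j) * form (v i) (v j)) = form (\<Sum>j\<in>J. u (v j) *s v j) (v i)"
      by (simp add: form_sum_left form_scale_left form_commute[of "v i"])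
    then show "(\<Sum>j\<in>J. u (v j) * form (v i) (v j)) = 0"
      using ortho[OF \<open>i \<in> I\<close>] x by simp
  qed (fact that)
  with x show ?thesis
    by simp
qed

lemma distance_self: "distance form P i i = 0"
  by (simp add: distance_def)

lemma distance_commute: "distance form P i j = distance form P j i"
  using form_minus_left[of "P j - P i"] form_minus_right[of _ "P j - P i"]
  by (simp add: distance_def)

lemma distance_matrix_eq_gram:
  assumes "i < n - 1" "j < n - 1"
  shows "distance_matrix form n P $$ (i, j) = - 2 * form (P (Suc i) - P n) (P (Suc j) - P n)"
  using assms by (simp add: distance_matrix_def distance_def form_simps
      form_commute[of "P (Suc j)" "P (Suc i)"] form_commute[of "P n" "P (Suc i)"]
      form_commute[of "P n" "P (Suc j)"])

end

text \<open>The rank is computed from the set of columns, in which equal columns count once; \<open>J\<close> contains one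
  index for each member of a maximal independent subset of that set.\<close>

lemma independent_columns_of_rank:
  fixes A :: "'k::field mat"
  assumes A: "A \<in> carrier_mat n m"
  obtains J where "J \<subseteq> {..<m}" "card J = vec_space.rank n A"
    "\<And>c j. (\<And>i. i < n \<Longrightarrow> (\<Sum>j\<in>J. c j * A $$ (i, j)) = 0) \<Longrightarrow> j \<in> J \<Longrightarrow> c j = 0"
proof -
  interpret vec_space "TYPE('k)" n .
  let ?P = "\<lambda>T. T \<subseteq> set (cols A) \<and> lin_indpt T"
  have "lin_indpt {}"
    by (auto simp: lin_dep_def)
  then obtain S where S: "maximal S ?P"
    using maximal_exists_superset[of "set (cols A)" ?P "{}"] by auto
  have SP: "S \<subseteq> set (cols A)" "lin_indpt S"
    using S by (auto simp: maximal_def)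
  have "set (cols A) = col A ` {..<m}"
    using A by (auto simp: cols_def)
  then obtain J where J: "J \<subseteq> {..<m}" "inj_on (col A) J" "S = col A ` J"
    using SP(1) subset_image_inj by metis
  have finJ: "finite J"
    using J(1) finite_subset by blast
  show ?thesis
  proof (rule that)
    show "J \<subseteq> {..<m}" by fact
    show "card J = rank A"
      using rank_card_indpt[OF A S] J by (simp add: card_image)
    fix c j assume c: "\<And>i. i < n \<Longrightarrow> (\<Sum>j\<in>J. c j * A $$ (i, j)) = 0" and j: "j \<in> J"
    let ?a = "\<lambda>v. c (the_inv_into J (col A) v)"
    have a: "?a (col A j) = c j" if "j \<in> J" for j
      using the_inv_into_f_f[OF J(2) that] by simp
    have S_carrier: "S \<subseteq> carrier_vec n"
      using SP(1) A cols_dim by blast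
    have "lincomb ?a S = 0\<^sub>v n"
    proof (rule eq_vecI)
      fix i assume "i < dim_vec (0\<^sub>v n :: 'k vec)"
      then have i: "i < n" by simp
      have "lincomb ?a S $ i = (\<Sum>v\<in>S. ?a v * v $ i)"
        by (rule lincomb_index[OF i S_carrier])
      also have "\<dots> = (\<Sum>j\<in>J. c j * A $$ (i, j))"
        unfolding J(3) sum.reindex[OF J(2)] using J(1) A i a by (intro sum.cong) auto
      finally show "lincomb ?a S $ i = 0\<^sub>v n $ i"
        using c[OF i] i by simp
    qed (use lincomb_dim[OF _ S_carrier] finJ J(3) in auto)
    then have "?a (col A j) = 0"
      using not_lindepD[OF SP(2), of S ?a] finJ j J(3) by auto
    then show "c j = 0"
      using a[OF j] by simp
  qed
qed

context symmetric_form
begin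

text \<open>The map \<open>P\<^sub>i - P\<^sub>n \<mapsto> Q\<^sub>i - Q\<^sub>n\<close> is given by the set of all pairs of combinations of the two families with
  the same coefficients. Orthogonality to this set can be tested in either component, which makes both
  components of such a pair radical vectors, hence zero.\<close>

theorem congruent_if_same_distance_matrix:
  assumes rank: "vec_space.rank (n - 1) (distance_matrix form n P) = min (n - 1) (dim (UNIV :: 'v set))"
    and eq: "distance_matrix form n Q = distance_matrix form n P"
    and n: "1 \<le> n"
  shows "\<exists>g \<in> orthogonal_maps scale form. \<forall>i\<in>{1..n}. g (P i - P n) = Q i - Q n"
proof -
  define I where "I = {..<n - 1}"
  define p where "p = (\<lambda>i. P (Suc i) - P n)"
  define q where "q = (\<lambda>i. Q (Suc i) - Q n)"
  have gram_p: "distance_matrix form n P $$ (i, j) = - 2 * form (p i) (p j)" if "i \<in> I" "j \<in> I" for i j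
    using that by (simp add: I_def p_def distance_matrix_eq_gram)
  have gram_q: "distance_matrix form n P $$ (i, j) = - 2 * form (q i) (q j)" if "i \<in> I" "j \<in> I" for i j
    using that by (simp add: I_def q_def distance_matrix_eq_gram flip: eq)
  have gram_eq: "form (p i) (p j) = form (q i) (q j)" if "i \<in> I" "j \<in> I" for i j
    using gram_p[OF that] gram_q[OF that] by simp
  have "distance_matrix form n P \<in> carrier_mat (n - 1) (n - 1)"
    by (simp add: distance_matrix_def)
  then obtain J where J: "J \<subseteq> I" "card J = min (card I) (dim (UNIV :: 'v set))"
    and J_indep: "\<And>c j. (\<And>i. i \<in> I \<Longrightarrow> (\<Sum>j\<in>J. c j * distance_matrix form n P $$ (i, j)) = 0)
      \<Longrightarrow> j \<in> J \<Longrightarrow> c j = 0"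
    using rank by (elim independent_columns_of_rank) (auto simp: I_def simp del: dim_UNIV)
  have nondegenerate: "(\<Sum>i\<in>I. a i *s v i) = 0"
    if gram: "\<And>i j. i \<in> I \<Longrightarrow> j \<in> I \<Longrightarrow> distance_matrix form n P $$ (i, j) = - 2 * form (v i) (v j)"
      and ortho: "\<And>i. i \<in> I \<Longrightarrow> form (\<Sum>i\<in>I. a i *s v i) (v i) = 0" for v a
  proof (rule radical_trivial[OF _ J _ ortho])
    show "finite I"
      by (simp add: I_def)
    fix c j assume c: "\<And>i. i \<in> I \<Longrightarrow> (\<Sum>j\<in>J. c j * form (v i) (v j)) = 0" and j: "j \<in> J"
    show "c j = 0"
    proof (rule J_indep)
      fix i assume i: "i \<in> I"
      have "(\<Sum>j\<in>J. c j * distance_matrix form n P $$ (i, j)) =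
          (\<Sum>j\<in>J. - 2 * (c j * form (v i) (v j)))"
        using J(1) i gram by (intro sum.cong) (auto simp: mult.left_commute)
      also have "\<dots> = - 2 * (\<Sum>j\<in>J. c j * form (v i) (v j))"
        by (rule sum_distrib_left[symmetric])
      finally show "(\<Sum>j\<in>J. c j * distance_matrix form n P $$ (i, j)) = 0"
        using c[OF i] by simp
    qed (fact j)
  qed
  define F where "F c = ((\<Sum>i\<in>I. c i *s p i), (\<Sum>i\<in>I. c i *s q i))" for c
  have form_F: "form (fst (F c)) (fst (F d)) = form (snd (F c)) (snd (F d))" for c d
    by (simp add: F_def form_sum_left form_sum_right form_scale_left form_scale_right gram_eq)
  have F_unit: "F (\<lambda>k. if k = i then 1 else 0) = (p i, q i)" if "i \<in> I" for i
  proof -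
    have "(\<Sum>k\<in>I. (if k = i then 1 else 0) *s v k) = v i" for v
    proof -
      have "(\<Sum>k\<in>I. (if k = i then 1 else 0) *s v k) = (\<Sum>k\<in>I. if k = i then v k else 0)"
        by (intro sum.cong) auto
      then show ?thesis
        using that by (simp add: I_def)
    qed
    then show ?thesis
      by (simp add: F_def)
  qed
  have "\<exists>g \<in> orthogonal_maps scale form. \<forall>s\<in>range F. g (fst s) = snd s"
  proof (rule nondegenerate_isometry_extends)
    fix s t assume "s \<in> range F" "t \<in> range F"
    then obtain c d where cd: "s = F c" "t = F d"
      by blast
    have "(fst s + fst t, snd s + snd t) = F (\<lambda>i. c i + d i)"
      by (simp add: cd F_def scale_left_distrib sum.distrib)
    then show "(fst s + fst t, snd s + snd t) \<in> range F"
      by blast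
    show "form (fst s) (fst t) = form (snd s) (snd t)"
      unfolding cd by (rule form_F)
  next
    fix k s assume "s \<in> range F"
    then obtain c where c: "s = F c"
      by blast
    have "(k *s fst s, k *s snd s) = F (\<lambda>i. k * c i)"
      by (simp add: c F_def scale_sum_right)
    then show "(k *s fst s, k *s snd s) \<in> range F"
      by blast
  next
    fix s assume "s \<in> range F" and ortho: "\<And>t. t \<in> range F \<Longrightarrow> form (fst s) (fst t) = 0"
    then obtain c where c: "s = F c"
      by blast
    have "form (fst s) (p i) = 0" "form (snd s) (q i) = 0" if "i \<in> I" for i
      using ortho[OF rangeI, of "\<lambda>k. if k = i then 1 else 0"] form_F[of c "\<lambda>k. if k = i then 1 else 0"]
      by (simp_all add: F_unit[OF that] c)
    then show "s = (0, 0)"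
      using nondegenerate[of p c] nondegenerate[of q c] gram_p gram_q by (simp add: c F_def)
  qed
  then obtain g where g: "g \<in> orthogonal_maps scale form" and gF: "\<And>c. g (fst (F c)) = snd (F c)"
    by blast
  have "g (P i - P n) = Q i - Q n" if i: "i \<in> {1..n}" for i
  proof (cases "i = n")
    case True
    then show ?thesis
      using orthogonal_maps_scale[OF g, of 0 0] by simp
  next
    case False
    then have "i - 1 \<in> I" "Suc (i - 1) = i"
      using i by (auto simp: I_def)
    then show ?thesis
      using gF F_unit[of "i - 1"] by (metis fst_conv snd_conv p_def q_def)
  qed
  with g show ?thesis
    by blast
qed

lemma orthogonal_then_translation_in_AO:
  assumes g: "g \<in> orthogonal_maps scale form"
  shows "(\<lambda>x. g x + t) \<in> carrier (AO scale form)"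
proof -
  have "bij (\<lambda>x. x + t)"
    by (rule o_bij[of "\<lambda>x. x - t"]) auto
  then have Bij: "g \<in> Bij UNIV" "(\<lambda>x. x + t) \<in> Bij UNIV"
    using orthogonal_maps_bij[OF g] by (auto simp: Bij_def)
  have "(\<lambda>x. x + t) \<otimes>\<^bsub>BijGroup UNIV\<^esub> g
      \<in> generate (BijGroup UNIV) (orthogonal_maps scale form \<union> translation_maps)"
    using g by (intro generate.eng generate.incl) (auto simp: translation_maps_def)
  then show ?thesis
    using Bij by (simp add: AO_def BijGroup_def compose_def restrict_def)
qed

end


section \<open>Configurations with the same distances nearby\<close>

text \<open>In a basis of \<open>V\<close>, a norm on \<open>V\<^sup>n\<close> becomes a norm on the coefficient families, so it controls
  every coefficient of every point.\<close>

lemma coordinates_tendsto_zero: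
  fixes scale :: "'k::{real_normed_field, complete_space} \<Rightarrow> 'v::ab_group_add \<Rightarrow> 'v"
  assumes V: "finite_dimensional_vector_space scale Basis"
    and N: "norm_on_configurations scale n N"
    and h: "\<And>k. h k \<in> configurations n" and lim: "(\<lambda>k. N (h k)) \<longlonglongrightarrow> 0"
    and i: "i \<in> {1..n}" and b: "b \<in> Basis"
  shows "(\<lambda>k. module.representation scale Basis (h k i) b) \<longlonglongrightarrow> 0"
proof -
  interpret finite_dimensional_vector_space scale Basis by fact
  define conf where "conf f = (\<lambda>i. if i \<in> {1..n} then \<Sum>b\<in>Basis. scale (f (i, b)) b else 0)"
    for f :: "nat \<times> 'v \<Rightarrow> 'k"
  have conf: "conf f \<in> configurations n" for f
    by (auto simp: conf_def configurations_def)
  have "\<exists>C\<ge>0. \<forall>f. (\<forall>p. p \<notin> {1..n} \<times> Basis \<longrightarrow> f p = 0) \<longrightarrow>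
      (\<forall>p\<in>{1..n} \<times> Basis. norm (f p) \<le> C * N (conf f))"
  proof (rule norm_bounds_coordinates)
    show "0 \<le> N (conf f)" for f
      using N conf by (auto simp: norm_on_configurations_def)
    have "conf (\<lambda>p. c * f p) = (\<lambda>i. scale c (conf f i))" for c f
      by (auto simp: conf_def scale_sum_right)
    then show "N (conf (\<lambda>p. c * f p)) = norm c * N (conf f)" for c f
      using N conf by (simp add: norm_on_configurations_def)
    have "conf (\<lambda>p. f p + g p) = (\<lambda>i. conf f i + conf g i)" for f g
      by (auto simp: conf_def scale_left_distrib sum.distrib)
    then show "N (conf (\<lambda>p. f p + g p)) \<le> N (conf f) + N (conf g)" for f g
      using N conf by (simp add: norm_on_configurations_def)
    show "finite ({1..n} \<times> Basis)"
      using finite_Basis by simp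
    fix f assume "N (conf f) = 0"
    then have zero: "conf f i = 0" for i
      using N conf by (simp add: norm_on_configurations_def)
    have "f (i, b) = 0" if "i \<in> {1..n}" "b \<in> Basis" for i b
      using independentD[OF independent_Basis finite_Basis subset_refl, of "\<lambda>b. f (i, b)" b]
        zero[of i] that by (simp add: conf_def)
    then show "\<forall>p\<in>{1..n} \<times> Basis. f p = 0"
      by auto
  qed
  then obtain C where C: "\<And>f p. (\<And>p. p \<notin> {1..n} \<times> Basis \<Longrightarrow> f p = 0) \<Longrightarrow> p \<in> {1..n} \<times> Basis \<Longrightarrow>
      norm (f p) \<le> C * N (conf f)"
    by blast
  have bound: "norm (representation Basis (h k i) b) \<le> C * N (h k)" for k
  proof -
    let ?f = "\<lambda>(i, b). if i \<in> {1..n} \<and> b \<in> Basis then representation Basis (h k i) b else 0"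
    have "conf ?f j = h k j" for j
    proof (cases "j \<in> {1..n}")
      case True
      then have "conf ?f j = (\<Sum>b\<in>Basis. scale (representation Basis (h k j) b) b)"
        by (simp add: conf_def)
      then show ?thesis
        using sum_representation_eq[OF independent_Basis _ finite_Basis subset_refl] span_Basis
        by simp
    next
      case False
      then show ?thesis
        using h[of k] by (auto simp: conf_def configurations_def)
    qed
    then have "conf ?f = h k"
      by auto
    moreover have "norm (?f (i, b)) \<le> C * N (conf ?f)"
      using i b by (intro C) (auto split: if_splits)
    ultimately show ?thesis
      using i b by simp
  qed
  moreover have "norm (N (h k)) = N (h k)" for k
    using N h by (simp add: norm_on_configurations_def)
  ultimately show ?thesis
    by (intro tendsto_0_le[OF lim, of _ C]) (simp add: mult.commute)
qed

text \<open>With one argument fixed the form is a finite combination of coordinates. When both arguments vary,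
  one of them is expanded in the basis, and the first case applies to the other.\<close>

lemma form_tendsto_zero:
  fixes scale :: "'k::real_normed_field \<Rightarrow> 'v::ab_group_add \<Rightarrow> 'v"
  assumes "symmetric_form scale Basis form"
    and lim: "\<And>b. b \<in> Basis \<Longrightarrow> (\<lambda>k. module.representation scale Basis (h k) b) \<longlonglongrightarrow> 0"
  shows "(\<lambda>k. form y (h k)) \<longlonglongrightarrow> 0" and "(\<lambda>k. form (h k) (h k)) \<longlonglongrightarrow> 0"
proof -
  interpret symmetric_form scale Basis form by fact
  have h: "(\<Sum>b\<in>Basis. scale (representation Basis (h k) b) b) = h k" for k
    using sum_representation_eq[OF independent_Basis _ finite_Basis subset_refl] span_Basis by simp
  have expand: "form x (h k) = (\<Sum>b\<in>Basis. representation Basis (h k) b * form x b)" for x k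
    by (subst h[symmetric]) (simp only: form_sum_right form_scale_right)
  have fixed: "(\<lambda>k. form x (h k)) \<longlonglongrightarrow> 0" for x
    unfolding expand
    by (intro tendsto_null_sum tendsto_mult_left_zero lim)
  then show "(\<lambda>k. form y (h k)) \<longlonglongrightarrow> 0" .
  have "(\<lambda>k. \<Sum>b\<in>Basis. representation Basis (h k) b * form (h k) b) \<longlonglongrightarrow> 0"
    unfolding form_commute[of "h _"]
    by (intro tendsto_null_sum tendsto_mult_zero lim fixed)
  then show "(\<lambda>k. form (h k) (h k)) \<longlonglongrightarrow> 0"
    by (subst expand)
qed

text \<open>Only finitely many values occur as distances of \<open>P\<close>. Each distance of a configuration with the same
  distribution is one of these, and if it is close enough to the corresponding distance of \<open>P\<close>,
  it cannot be a different one. So near \<open>P\<close> the labels of the distances are determined.\<close>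

lemma same_distances_nearby:
  fixes scale :: "'k::{real_normed_field, complete_space} \<Rightarrow> 'v::ab_group_add \<Rightarrow> 'v"
  assumes V: "symmetric_form scale Basis form"
    and N: "norm_on_configurations scale n N" and P: "P \<in> configurations n"
  shows "\<exists>\<epsilon>>0. \<forall>Q \<in> configurations n.
    distance_distribution form n Q = distance_distribution form n P \<longrightarrow> N (\<lambda>i. Q i - P i) < \<epsilon> \<longrightarrow>
    (\<forall>i\<in>{1..n}. \<forall>j\<in>{1..n}. distance form Q i j = distance form P i j)"
proof (rule ccontr)
  interpret symmetric_form scale Basis form by fact
  assume neg: "\<not> ?thesis"
  have counterexample: "\<exists>Q. Q \<in> configurations n \<and>
      distance_distribution form n Q = distance_distribution form n P \<and> N (\<lambda>i. Q i - P i) < \<epsilon> \<and>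
      \<not> (\<forall>i\<in>{1..n}. \<forall>j\<in>{1..n}. distance form Q i j = distance form P i j)" if "0 < \<epsilon>" for \<epsilon>
    using neg that by blast
  have "\<forall>k. \<exists>Q. Q \<in> configurations n \<and>
      distance_distribution form n Q = distance_distribution form n P \<and>
      N (\<lambda>i. Q i - P i) < inverse (real (Suc k)) \<and>
      \<not> (\<forall>i\<in>{1..n}. \<forall>j\<in>{1..n}. distance form Q i j = distance form P i j)"
    by (intro allI counterexample) simp
  from choice[OF this] obtain Q where Q: "\<And>k. Q k \<in> configurations n"
    and distribution: "\<And>k. distance_distribution form n (Q k) = distance_distribution form n P"
    and near: "\<And>k. N (\<lambda>i. Q k i - P i) < inverse (real (Suc k))"
    and different: "\<And>k. \<not> (\<forall>i\<in>{1..n}. \<forall>j\<in>{1..n}. distance form (Q k) i j = distance form P i j)"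
    by blast
  define h where "h k i = Q k i - P i" for k i
  have h: "h k \<in> configurations n" for k
    using Q[of k] P by (simp add: h_def configurations_def)
  have "(\<lambda>k. N (h k)) \<longlonglongrightarrow> 0"
  proof (rule tendsto_sandwich)
    show "\<forall>\<^sub>F k in sequentially. 0 \<le> N (h k)"
      using N h by (simp add: norm_on_configurations_def)
    show "\<forall>\<^sub>F k in sequentially. N (h k) \<le> inverse (real (Suc k))"
      using near by (intro always_eventually) (auto simp: h_def[abs_def] less_imp_le)
  qed (use LIMSEQ_inverse_real_of_nat in auto)
  then have coord: "(\<lambda>k. representation Basis (h k i) b) \<longlonglongrightarrow> 0" if "i \<in> {1..n}" "b \<in> Basis" for i b
    by (rule coordinates_tendsto_zero[where h = h, OF finite_dimensional_vector_space_axioms N h _ that])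
  have distance_lim: "(\<lambda>k. distance form (Q k) i j) \<longlonglongrightarrow> distance form P i j"
    if ij: "i \<in> {1..n}" "j \<in> {1..n}" for i j
  proof -
    have "(\<lambda>k. representation Basis (h k i - h k j) b) \<longlonglongrightarrow> 0" if "b \<in> Basis" for b
      using tendsto_diff[OF coord[OF ij(1) that] coord[OF ij(2) that]]
      by (simp add: representation_diff[OF independent_Basis] span_Basis)
    note lim = form_tendsto_zero[OF V this]
    have "distance form (Q k) i j = distance form P i j +
        2 * form (P i - P j) (h k i - h k j) + form (h k i - h k j) (h k i - h k j)" for k
    proof -
      have "Q k i - Q k j = (P i - P j) + (h k i - h k j)"
        by (simp add: h_def)
      then show ?thesis
        unfolding distance_def
        by (simp only: form_add_left form_add_right form_commute[of "h k i - h k j" "P i - P j"])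
          simp
    qed
    moreover have "(\<lambda>k. distance form P i j +
        2 * form (P i - P j) (h k i - h k j) + form (h k i - h k j) (h k i - h k j))
        \<longlonglongrightarrow> distance form P i j + 2 * 0 + 0"
      by (intro tendsto_intros lim)
    ultimately show ?thesis
      by simp
  qed
  have increasing: "\<forall>\<^sub>F k in sequentially. distance form (Q k) i j = distance form P i j"
    if ij: "1 \<le> i" "i < j" "j \<le> n" for i j
  proof -
    let ?D = "set_mset (distance_distribution form n P)"
    have pairs: "finite {(i, j). 1 \<le> i \<and> i < j \<and> j \<le> n}"
      by (rule finite_subset[of _ "{1..n} \<times> {1..n}"]) auto
    have in_D: "distance form (Q k) i j \<in> ?D" for k
    proof -
      have "distance form (Q k) i j \<in> set_mset (distance_distribution form n (Q k))"
        using pairs ij by (force simp: distance_distribution_def)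
      then show ?thesis
        by (simp add: distribution)
    qed
    have "open (- (?D - {distance form P i j}))"
      by (intro open_Compl finite_imp_closed) simp
    from topological_tendstoD[OF distance_lim this, of i j]
    have "\<forall>\<^sub>F k in sequentially. distance form (Q k) i j \<in> - (?D - {distance form P i j})"
      using ij by simp
    then show ?thesis
      by (rule eventually_mono) (use in_D in blast)
  qed
  have "\<forall>\<^sub>F k in sequentially. distance form (Q k) i j = distance form P i j"
    if "i \<in> {1..n}" "j \<in> {1..n}" for i j
  proof (cases i j rule: linorder_cases)
    case less
    then show ?thesis
      using that by (intro increasing) auto
  next
    case equal
    then show ?thesis
      by (simp add: distance_self)
  next
    case greater
    then show ?thesis
      unfolding distance_commute[of _ i j] using that by (intro increasing) auto
  qed
  then have "\<forall>\<^sub>F k in sequentially.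
      \<forall>i\<in>{1..n}. \<forall>j\<in>{1..n}. distance form (Q k) i j = distance form P i j"
    by (intro eventually_ball_finite ballI) auto
  from eventually_happens'[OF sequentially_bot this] show False
    using different by blast
qed

theorem proposition1p13:
  fixes scale :: "'k::real_or_complex \<Rightarrow> 'v::ab_group_add \<Rightarrow> 'v"
    and Basis :: "'v set"
    and form :: "'v \<Rightarrow> 'v \<Rightarrow> 'k"
    and N :: "(nat \<Rightarrow> 'v) \<Rightarrow> real"
    and P :: "nat \<Rightarrow> 'v"
    and m n r :: nat
  assumes "finite_dimensional_vector_space scale Basis"
    and "vector_space.dim scale (UNIV :: 'v set) = m"
    and "nondegenerate_symmetric_bilinear_form scale form"
    and "1 \<le> n"
    and "norm_on_configurations scale n N"
    and "r = min (n - 1) m"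
    and "P \<in> configurations n"
    and "vec_space.rank (n - 1) (distance_matrix form n P) = r"
  shows "\<exists>\<epsilon>>0. \<forall>Q \<in> configurations n.
           distance_distribution form n Q = distance_distribution form n P \<longrightarrow>
           N (\<lambda>i. Q i - P i) < \<epsilon> \<longrightarrow>
           Q \<in> orbit (AO scale form) (diagonal_action n) P"
proof -
  interpret finite_dimensional_vector_space scale Basis by fact
  have V: "symmetric_form scale Basis form"
    using assms(3) by unfold_locales
      (auto simp: nondegenerate_symmetric_bilinear_form_def Vector_Spaces.linear_iff)
  interpret symmetric_form scale Basis form by fact
  obtain \<epsilon> where "0 < \<epsilon>" and \<epsilon>: "\<And>Q. Q \<in> configurations n \<Longrightarrow>
      distance_distribution form n Q = distance_distribution form n P \<Longrightarrow> N (\<lambda>i. Q i - P i) < \<epsilon> \<Longrightarrow>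
      \<forall>i\<in>{1..n}. \<forall>j\<in>{1..n}. distance form Q i j = distance form P i j"
    using same_distances_nearby[OF V assms(5,7)] by blast
  have "Q \<in> orbit (AO scale form) (diagonal_action n) P"
    if Q: "Q \<in> configurations n"
      and same: "\<forall>i\<in>{1..n}. \<forall>j\<in>{1..n}. distance form Q i j = distance form P i j" for Q
  proof -
    have matrix_eq: "distance_matrix form n Q = distance_matrix form n P"
      unfolding distance_matrix_def using same by (intro cong_mat) auto
    obtain g where g: "g \<in> orthogonal_maps scale form"
      and gP: "\<And>i. i \<in> {1..n} \<Longrightarrow> g (P i - P n) = Q i - Q n"
      using congruent_if_same_distance_matrix[OF _ matrix_eq assms(4)] assms(2,6,8) by metis
    define a where "a = (\<lambda>x. g x + (Q n - g (P n)))"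
    have "a (P i) = Q i" if "i \<in> {1..n}" for i
      using gP[OF that] orthogonal_maps_add[OF g, of "P i - P n" "P n"]
      by (simp add: a_def)
    then have "diagonal_action n a P = Q"
      using Q by (auto simp: diagonal_action_def configurations_def)
    moreover have "a \<in> carrier (AO scale form)"
      unfolding a_def by (rule orthogonal_then_translation_in_AO[OF g])
    ultimately show ?thesis
      unfolding orbit_def by blast
  qed
  with \<open>0 < \<epsilon>\<close> \<epsilon> show ?thesis
    by blast
qed

end
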